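(* Let $\mu > 0$, let $\sigma \in (0,1)$, and set $\mu^+ = \sigma\mu$. For $\nu > 0$ and $v\in\mathbb{R}$ define $\lambda_\nu(v) = b_\nu(v)$ and $s_\nu(v) = b_\nu(-v)$, where $b_\nu$ is the softplus map $$b_\nu(v) = \frac{v + \sqrt{v^2 + 4\nu}}{2}.$$ Then for any fixed real $v \neq 0$: (i) if $v > 0$, then $$0 < s_{\mu^+}(v) \le \frac{\sigma\mu}{v} \quad\text{and}\quad 0 \le \lambda_\mu(v) - \lambda_{\mu^+}(v) \le \frac{(1-\sigma)\mu}{v};$$ (ii) if $v < 0$, then $$0 < \lambda_{\mu^+}(v) \le \frac{\sigma\mu}{|v|} \quad\text{and}\quad 0 \le s_\mu(v) - s_{\mu^+}(v) \le \frac{(1-\sigma)\mu}{|v|}.$$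
   Context: All quantities are real scalars. *)

theory Defs
  imports Complex_Main
begin

(* All three maps are meant for nu > 0; lam and slack stand for lambda_nu and s_nu. *)

definition softplus :: "real \<Rightarrow> real \<Rightarrow> real" where
  "softplus \<nu> v = (v + sqrt (v\<^sup>2 + 4 * \<nu>)) / 2"

definition lam :: "real \<Rightarrow> real \<Rightarrow> real" where
  "lam \<nu> v = softplus \<nu> v"

definition slack :: "real \<Rightarrow> real \<Rightarrow> real" where
  "slack \<nu> v = softplus \<nu> (- v)"

end

theory Submission
  imports Defs
begin

text \<open>With \<open>w\<close> = \<open>\<bar>v\<bar>\<close>, both cases concern a growing
  branch \<open>softplus \<nu> w\<close> and a vanishing branch \<open>softplus \<nu> (- w)\<close>.
  Rationalizing the difference of two square roots, each at least \<open>w\<close>, shows that the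
  growing branch changes by at most 1/\<open>w\<close> times the change in \<open>\<nu>\<close>
  (\<open>softplus_diff_le\<close>). The vanishing branch is the growing one minus \<open>w\<close>,
  so \<open>softplus_minus_le\<close> inherits its bound.\<close>

lemma softplus_mono:
  assumes "a \<le> b"
  shows "softplus a w \<le> softplus b w"
  using assms by (simp add: softplus_def)

lemma softplus_diff_le:
  assumes "w > 0" "0 \<le> a" "a \<le> b"
  shows "softplus b w - softplus a w \<le> (b - a) / w"
proof -
  define r where "r = sqrt (w\<^sup>2 + 4 * a)"
  define s where "s = sqrt (w\<^sup>2 + 4 * b)"
  have "w \<le> r" "r \<le> s"
    using assms by (auto simp: r_def s_def intro: real_le_rsqrt)
  then have "(s - r) * (2 * w) \<le> (s - r) * (s + r)"
    by (intro mult_left_mono) auto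
  also have "\<dots> = s\<^sup>2 - r\<^sup>2"
    by (simp add: power2_eq_square algebra_simps)
  also have "\<dots> = 4 * (b - a)"
    using assms by (simp add: r_def s_def)
  finally have "(s - r) / 2 \<le> (b - a) / w"
    using \<open>w > 0\<close> by (simp add: field_simps)
  then show ?thesis
    by (simp add: softplus_def r_def s_def diff_divide_distrib add_divide_distrib)
qed

lemma softplus_pos:
  assumes "\<nu> > 0"
  shows "0 < softplus \<nu> v"
proof -
  have "\<bar>v\<bar> < sqrt (v\<^sup>2 + 4 * \<nu>)"
    using assms by (intro real_less_rsqrt) simp
  then show ?thesis
    by (simp add: softplus_def)
qed

text \<open>For \<open>w > 0\<close> one has \<open>softplus 0 w = w\<close>, so the bound on the vanishing branch is the case
  \<open>a = 0\<close> of the difference bound.\<close>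

lemma softplus_minus_le:
  assumes "w > 0" "\<nu> \<ge> 0"
  shows "softplus \<nu> (- w) \<le> \<nu> / w"
proof -
  have "softplus \<nu> (- w) = softplus \<nu> w - softplus 0 w"
    using assms by (simp add: softplus_def field_simps)
  then show ?thesis
    using softplus_diff_le[of w 0 \<nu>] assms by simp
qed

theorem theorem2:
  fixes \<mu> \<sigma> \<mu>p v :: real
  assumes "\<mu> > 0"
    and "\<sigma> \<in> {0<..<1}"
    and "\<mu>p = \<sigma> * \<mu>"
    and "v \<noteq> 0"
  shows "(v > 0 \<longrightarrow>
            (0 < slack \<mu>p v \<and> slack \<mu>p v \<le> \<sigma> * \<mu> / v) \<and>
            (0 \<le> lam \<mu> v - lam \<mu>p v \<and> lam \<mu> v - lam \<mu>p v \<le> (1 - \<sigma>) * \<mu> / v)) \<and>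
         (v < 0 \<longrightarrow>
            (0 < lam \<mu>p v \<and> lam \<mu>p v \<le> \<sigma> * \<mu> / \<bar>v\<bar>) \<and>
            (0 \<le> slack \<mu> v - slack \<mu>p v \<and> slack \<mu> v - slack \<mu>p v \<le> (1 - \<sigma>) * \<mu> / \<bar>v\<bar>))"
proof -
  have \<mu>p: "0 < \<mu>p" "\<mu>p \<le> \<mu>" and diff: "(1 - \<sigma>) * \<mu> = \<mu> - \<mu>p"
    using assms by (auto simp: algebra_simps)
  have *: "(0 < softplus \<mu>p (- w) \<and> softplus \<mu>p (- w) \<le> \<mu>p / w) \<and>
      (0 \<le> softplus \<mu> w - softplus \<mu>p w \<and> softplus \<mu> w - softplus \<mu>p w \<le> (\<mu> - \<mu>p) / w)"
    if "w > 0" for w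
    using that \<mu>p softplus_pos softplus_mono softplus_minus_le softplus_diff_le by simp
  show ?thesis
    \<comment> \<open>Negating \<open>v\<close> exchanges \<open>lam\<close> and
      \<open>slack\<close>, so the instance at \<open>- v\<close> is the case of negative
      \<open>v\<close>.\<close>
    using *[of v] *[of "- v"]
    by (simp add: lam_def slack_def diff flip: \<open>\<mu>p = \<sigma> * \<mu>\<close>)
qed

end
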